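(* Let $\ell>0$ be an integer and let $(\alpha_1,\alpha_2)\in(0,\pi)^2$ be such that $\alpha_1+\alpha_2\ne\pi m/\ell$ and $\alpha_1-\alpha_2+\pi\neq\pi m/\ell$ for all integers $m$ with $0<m<\ell$ or $\ell<m<2\ell$. Let $T_{2\ell}(x)$ be the Chebyshev polynomial of the first kind of degree $2\ell$. Then, for $\phi\in(0,\pi)$ and $\theta\in[0,2\pi]$, the equation $$\cos(\theta)\;=\;\frac{(|\mathbf n|^2P_1-d\,\mathbf n)\cdot Q_1}{\sin^2(\alpha_2)\sin^2(\phi)}$$ is equivalent to the equation $$\cos(\theta)\;=\;T_{2\ell}\big(\cos(\alpha_1)\cos(\alpha_2)-\cos(\phi)\sin(\alpha_1)\sin(\alpha_2)\big),$$ where $P_1,Q_1,\mathbf n,d$ are the functions of $\phi$ (depending on $\alpha_1,\alpha_2,\ell$) defined in the context.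
   Context: $T_m$ is the polynomial of degree $m$ with $T_m(\cos\psi)=\cos(m\psi)$. $\mathrm{SU}(2)$ is identified with the unit quaternions; purely imaginary quaternions $u\mathbf i+v\mathbf j+w\mathbf k$ are identified with vectors $(u,v,w)\in\mathbb R^3$, and $\cdot$ and $|\ |$ denote the Euclidean dot product and norm. For a purely imaginary unit quaternion $Q$ write $e^{\alpha Q}=\cos\alpha+\sin\alpha\,Q$. For $\phi\in(0,\pi)$ put $P_1=\mathbf i e^{-\mathbf k\phi}=\cos(\phi)\mathbf i+\sin(\phi)\mathbf j$, $X_1=e^{\alpha_1P_1}$, $X_2=e^{\alpha_2\mathbf i}$. Define $(Y_1,Y_2)=(X_1,X_2)\,\sigma_1^{2\ell}$, the result of applying $2\ell$ times the map $(X_1,X_2)\mapsto (X_1X_2X_1^{-1},X_1)$, and define the purely imaginary unit quaternion $Q_1$ by $Y_1=e^{\alpha_1Q_1}$. Further, $$d=\sin(\alpha_1)\cos(\alpha_2)+\cos(\alpha_1)\sin(\alpha_2)\cos(\phi),$$ $$\mathbf n=\begin{pmatrix}\sin(\alpha_1)\cos(\alpha_2)\cos(\phi)+\cos(\alpha_1)\sin(\alpha_2)\\ \sin(\alpha_1)\cos(\alpha_2)\sin(\phi)\\ -\sin(\alpha_1)\sin(\alpha_2)\sin(\phi)\end{pmatrix}.$$ *)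

theory Defs
  imports "HOL-Analysis.Analysis" "HOL-Computational_Algebra.Polynomial"
begin

section \<open>Chebyshev polynomials of the first kind\<close>

definition is_chebyshev_T :: "nat \<Rightarrow> real poly \<Rightarrow> bool" where
  "is_chebyshev_T m p \<longleftrightarrow>
     degree p = m \<and> (\<forall>\<psi>. poly p (cos \<psi>) = cos (real m * \<psi>))"

definition chebyshev_T :: "nat \<Rightarrow> real poly" where
  "chebyshev_T m = (THE p. is_chebyshev_T m p)"

lemma is_chebyshev_T_unique:
  assumes "is_chebyshev_T m p" "is_chebyshev_T m q"
  shows "p = q"
proof (rule ccontr)
  assume "p \<noteq> q"
  hence "finite {x. poly (p - q) x = 0}"
    by (intro poly_roots_finite) simp
  moreover have "{-1..1} \<subseteq> {x. poly (p - q) x = 0}"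
  proof
    fix x :: real assume "x \<in> {-1..1}"
    hence "cos (arccos x) = x" by (simp add: cos_arccos)
    moreover have "poly p (cos (arccos x)) = poly q (cos (arccos x))"
      using assms by (simp add: is_chebyshev_T_def)
    ultimately show "x \<in> {x. poly (p - q) x = 0}" by simp
  qed
  ultimately have "finite {-1..1::real}" by (rule rev_finite_subset)
  thus False by (simp add: infinite_Icc)
qed

lemma is_chebyshev_T_step:
  assumes p: "is_chebyshev_T m p" and q: "is_chebyshev_T (Suc m) q"
  shows "is_chebyshev_T (Suc (Suc m)) ([:0, 2:] * q - p)"
proof -
  have "q \<noteq> 0" using q by (auto simp: is_chebyshev_T_def)
  hence d: "degree ([:0, 2:] * q) = Suc (Suc m)"
    using q by (subst degree_mult_eq) (auto simp: is_chebyshev_T_def)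
  have "degree ([:0, 2:] * q - p) = Suc (Suc m)"
    using p by (subst diff_conv_add_uminus, subst degree_add_eq_left)
               (auto simp del: mult_pCons_left simp: d is_chebyshev_T_def)
  moreover have "poly ([:0, 2:] * q - p) (cos t) = cos (real (Suc (Suc m)) * t)" for t
  proof -
    have "cos (real (Suc (Suc m)) * t) = cos (real (Suc m) * t + t)"
      by (simp add: algebra_simps)
    moreover have "cos (real m * t) = cos (real (Suc m) * t - t)"
      by (simp add: algebra_simps)
    ultimately show ?thesis
      using p q by (simp add: is_chebyshev_T_def cos_add cos_diff del: of_nat_Suc)
  qed
  ultimately show ?thesis by (simp add: is_chebyshev_T_def)
qed

lemma is_chebyshev_T_exists: "(\<exists>p. is_chebyshev_T m p) \<and> (\<exists>p. is_chebyshev_T (Suc m) p)"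
proof (induction m)
  case 0
  have "is_chebyshev_T 0 [:1:]" "is_chebyshev_T (Suc 0) [:0, 1:]"
    by (auto simp: is_chebyshev_T_def)
  thus ?case by blast
next
  case (Suc m)
  thus ?case using is_chebyshev_T_step by blast
qed

lemma is_chebyshev_T_chebyshev_T: "is_chebyshev_T m (chebyshev_T m)"
  unfolding chebyshev_T_def
  using is_chebyshev_T_exists is_chebyshev_T_unique by (metis theI)


section \<open>Quaternions\<close>

text \<open>
  A quaternion is stored as its real part together with its imaginary part in \<open>\<real>\<^sup>3\<close>,
  so that \<open>qVec\<close> and \<open>qImag\<close> realise the identification of purely imaginary
  quaternions with vectors.
\<close>

datatype quat = Quat (qRe: real) (qVec: "real^3")

lemma quat_eq_iff: "x = y \<longleftrightarrow> qRe x = qRe y \<and> qVec x = qVec y"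
  by (cases x; cases y) auto

abbreviation qImag :: "real^3 \<Rightarrow> quat" where
  "qImag v \<equiv> Quat 0 v"

instantiation quat :: real_div_algebra
begin

definition "0 = Quat 0 0"
definition "1 = Quat 1 0"
definition "x + y = Quat (qRe x + qRe y) (qVec x + qVec y)"
definition "- x = Quat (- qRe x) (- qVec x)"
definition "x - y = Quat (qRe x - qRe y) (qVec x - qVec y)"
definition "r *\<^sub>R x = Quat (r * qRe x) (r *\<^sub>R qVec x)"
definition "x * y = Quat (qRe x * qRe y - qVec x \<bullet> qVec y)
  (qRe x *\<^sub>R qVec y + qRe y *\<^sub>R qVec x + cross3 (qVec x) (qVec y))"
definition "inverse x =
  (1 / ((qRe x)\<^sup>2 + (norm (qVec x))\<^sup>2)) *\<^sub>R Quat (qRe x) (- qVec x)"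
definition "x div y = x * inverse y" for x y :: quat

lemmas quat_defs = zero_quat_def one_quat_def plus_quat_def uminus_quat_def minus_quat_def
  scaleR_quat_def times_quat_def inverse_quat_def divide_quat_def

instance
proof
  fix x y z :: quat and r s :: real
  show "x * y * z = x * (y * z)"
    by (simp add: quat_defs quat_eq_iff vec_eq_iff forall_3 cross3_def inner_vec_def sum_3
        algebra_simps)
  show "inverse x * x = 1" "x * inverse x = 1" if "x \<noteq> 0"
  proof -
    define N where "N = qRe x * qRe x + qVec x \<bullet> qVec x"
    have N: "(qRe x)\<^sup>2 + (norm (qVec x))\<^sup>2 = N"
      by (simp only: N_def power2_norm_eq_inner) (simp add: power2_eq_square)
    have "N \<noteq> 0"
      using that unfolding N[symmetric]
      by (auto simp: quat_defs quat_eq_iff add_nonneg_eq_0_iff)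
    moreover have "qRe x * qRe x / N + qVec x \<bullet> qVec x / N = N / N"
      unfolding add_divide_distrib[symmetric] N_def by (rule refl)
    ultimately show "inverse x * x = 1" "x * inverse x = 1"
      unfolding inverse_quat_def N
      by (simp_all add: quat_defs quat_eq_iff cross_mult_left cross_mult_right)
  qed
  show "(x + y) * z = x * z + y * z"
    by (simp add: quat_defs quat_eq_iff vec_eq_iff forall_3 cross3_def inner_vec_def sum_3
        algebra_simps)
  show "x * (y + z) = x * y + x * z"
    by (simp add: quat_defs quat_eq_iff vec_eq_iff forall_3 cross3_def inner_vec_def sum_3
        algebra_simps)
  show "r *\<^sub>R x * y = r *\<^sub>R (x * y)" "x * r *\<^sub>R y = r *\<^sub>R (x * y)"
    by (simp_all add: quat_defs quat_eq_iff vec_eq_iff forall_3 cross3_def inner_vec_def sum_3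
        algebra_simps)
qed (auto simp: quat_defs quat_eq_iff scaleR_add_right scaleR_add_left distrib_left distrib_right)

end

definition qi :: quat where "qi = qImag (vector [1, 0, 0])"
definition qj :: quat where "qj = qImag (vector [0, 1, 0])"
definition qk :: quat where "qk = qImag (vector [0, 0, 1])"

lemma qi_qj_qk_mult:
  "qi * qi = -1" "qj * qj = -1" "qk * qk = -1"
  "qi * qj = qk" "qj * qk = qi" "qk * qi = qj"
  "qj * qi = -qk" "qk * qj = -qi" "qi * qk = -qj"
  by (simp_all add: qi_def qj_def qk_def quat_defs quat_eq_iff vec_eq_iff forall_3 cross3_def
      inner_vec_def sum_3 vector_3)

definition imag_unit :: "quat \<Rightarrow> bool" where
  "imag_unit Q \<longleftrightarrow> qRe Q = 0 \<and> norm (qVec Q) = 1"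

text \<open>The notation \<open>e\<^sup>\<alpha>\<^sup>Q\<close>, meaningful for purely imaginary unit quaternions \<open>Q\<close>.\<close>

definition qexp :: "real \<Rightarrow> quat \<Rightarrow> quat" where
  "qexp \<alpha> Q = of_real (cos \<alpha>) + sin \<alpha> *\<^sub>R Q"


section \<open>The braid action and the functions of the angle\<close>

definition sigma1 :: "quat \<times> quat \<Rightarrow> quat \<times> quat" where
  "sigma1 = (\<lambda>(X1, X2). (X1 * X2 * inverse X1, X1))"

definition P1 :: "real \<Rightarrow> quat" where
  "P1 \<phi> = qi * qexp (- \<phi>) qk"

definition Y1 :: "nat \<Rightarrow> real \<Rightarrow> real \<Rightarrow> real \<Rightarrow> quat" where
  "Y1 l \<alpha>1 \<alpha>2 \<phi> = fst ((sigma1 ^^ (2 * l)) (qexp \<alpha>1 (P1 \<phi>), qexp \<alpha>2 qi))"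

text \<open>
  For \<open>0 < \<alpha>1 < \<pi>\<close> this describes exactly one quaternion, see \<open>Q1_ex1\<close> below.
\<close>

definition Q1 :: "nat \<Rightarrow> real \<Rightarrow> real \<Rightarrow> real \<Rightarrow> quat" where
  "Q1 l \<alpha>1 \<alpha>2 \<phi> = (THE Q. imag_unit Q \<and> Y1 l \<alpha>1 \<alpha>2 \<phi> = qexp \<alpha>1 Q)"

definition dfun :: "real \<Rightarrow> real \<Rightarrow> real \<Rightarrow> real" where
  "dfun \<alpha>1 \<alpha>2 \<phi> = sin \<alpha>1 * cos \<alpha>2 + cos \<alpha>1 * sin \<alpha>2 * cos \<phi>"

definition nvec :: "real \<Rightarrow> real \<Rightarrow> real \<Rightarrow> real^3" where
  "nvec \<alpha>1 \<alpha>2 \<phi> = vector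
     [sin \<alpha>1 * cos \<alpha>2 * cos \<phi> + cos \<alpha>1 * sin \<alpha>2,
      sin \<alpha>1 * cos \<alpha>2 * sin \<phi>,
      - (sin \<alpha>1 * sin \<alpha>2 * sin \<phi>)]"

lemma P1_eq: "P1 \<phi> = cos \<phi> *\<^sub>R qi + sin \<phi> *\<^sub>R qj"
  by (simp add: P1_def qexp_def of_real_def right_diff_distrib qi_qj_qk_mult)

lemma imag_unit_qi: "imag_unit qi"
  by (simp add: imag_unit_def qi_def norm_eq_sqrt_inner inner_vec_def sum_3 vector_3)

lemma imag_unit_P1: "imag_unit (P1 \<phi>)"
  by (simp add: imag_unit_def P1_eq qi_def qj_def quat_defs norm_eq_sqrt_inner inner_vec_def
      sum_3 vector_3 flip: power2_eq_square)

lemma qexp_nonzero: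
  assumes "imag_unit Q"
  shows "qexp \<alpha> Q \<noteq> 0"
proof
  assume "qexp \<alpha> Q = 0"
  hence c: "cos \<alpha> = 0" and s: "sin \<alpha> *\<^sub>R qVec Q = 0"
    using assms by (auto simp: qexp_def of_real_def quat_defs quat_eq_iff imag_unit_def)
  from s have "sin \<alpha> = 0" using assms by (auto simp: imag_unit_def)
  with c show False using sin_cos_squared_add[of \<alpha>] by simp
qed

lemma imag_unit_iff: "imag_unit Q \<longleftrightarrow> Q * Q = -1"
proof
  assume "imag_unit Q"
  thus "Q * Q = -1"
    by (auto simp: imag_unit_def quat_defs quat_eq_iff cross_refl norm_eq_sqrt_inner)
next
  assume A: "Q * Q = -1"
  have re: "qRe Q * qRe Q - qVec Q \<bullet> qVec Q = -1"
    using arg_cong[OF A, of qRe] by (simp add: quat_defs)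
  have "qRe Q *\<^sub>R qVec Q + qRe Q *\<^sub>R qVec Q = 0"
    using arg_cong[OF A, of qVec] by (simp add: quat_defs)
  hence im: "(2 * qRe Q) *\<^sub>R qVec Q = 0"
    by (simp only: mult_2 scaleR_left_distrib)
  have "qRe Q = 0"
  proof (rule ccontr)
    assume "qRe Q \<noteq> 0"
    with im have "qVec Q = 0" by simp
    with re have "qRe Q * qRe Q = -1" by simp
    thus False by (smt (verit) zero_le_square)
  qed
  with re show "imag_unit Q" by (simp add: imag_unit_def norm_eq_sqrt_inner)
qed

lemma qexp_conj:
  assumes "g \<noteq> 0"
  shows "g * qexp \<alpha> Q * inverse g = qexp \<alpha> (g * Q * inverse g)"
  using assms by (simp add: qexp_def of_real_def distrib_left distrib_right)

lemma imag_unit_conj: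
  assumes "g \<noteq> 0" "imag_unit Q"
  shows "imag_unit (g * Q * inverse g)"
proof -
  have "(g * Q * inverse g) * (g * Q * inverse g) = g * Q * (inverse g * g) * Q * inverse g"
    by (simp only: mult.assoc)
  also have "\<dots> = g * (Q * Q) * inverse g"
    using assms(1) by (simp add: mult.assoc)
  also have "\<dots> = -1"
    using assms by (simp add: imag_unit_iff)
  finally show ?thesis by (simp add: imag_unit_iff)
qed

lemma sigma1_even_orbit:
  "\<exists>A B. imag_unit A \<and> imag_unit B \<and>
     (sigma1 ^^ (2 * l)) (qexp \<alpha>1 (P1 \<phi>), qexp \<alpha>2 qi) = (qexp \<alpha>1 A, qexp \<alpha>2 B)"
proof (induction l)
  case 0
  thus ?case using imag_unit_P1 imag_unit_qi by auto
next
  case (Suc l)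
  then obtain A B where AB: "imag_unit A" "imag_unit B"
    "(sigma1 ^^ (2 * l)) (qexp \<alpha>1 (P1 \<phi>), qexp \<alpha>2 qi) = (qexp \<alpha>1 A, qexp \<alpha>2 B)"
    by blast
  let ?g = "qexp \<alpha>1 A"
  define B' where "B' = ?g * B * inverse ?g"
  have B': "imag_unit B'" "?g * qexp \<alpha>2 B * inverse ?g = qexp \<alpha>2 B'"
    using AB(1,2) by (auto simp: B'_def qexp_conj qexp_nonzero imag_unit_conj)
  define A' where "A' = qexp \<alpha>2 B' * A * inverse (qexp \<alpha>2 B')"
  have A': "imag_unit A'" "qexp \<alpha>2 B' * ?g * inverse (qexp \<alpha>2 B') = qexp \<alpha>1 A'"
    using AB(1) B'(1) by (auto simp: A'_def qexp_conj qexp_nonzero imag_unit_conj)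
  have "(sigma1 ^^ (2 * Suc l)) (qexp \<alpha>1 (P1 \<phi>), qexp \<alpha>2 qi) =
      sigma1 (sigma1 (qexp \<alpha>1 A, qexp \<alpha>2 B))"
    using AB(3) by simp
  also have "\<dots> = (qexp \<alpha>1 A', qexp \<alpha>2 B')"
    by (simp add: sigma1_def A'(2) B'(2))
  finally show ?case using A' B' by blast
qed

lemma Q1_ex1:
  assumes "0 < \<alpha>1" "\<alpha>1 < pi"
  shows "\<exists>!Q. imag_unit Q \<and> Y1 l \<alpha>1 \<alpha>2 \<phi> = qexp \<alpha>1 Q"
proof -
  have "sin \<alpha>1 \<noteq> 0" using sin_gt_zero[OF assms] by simp
  hence uniq: "Q = Q'" if "qexp \<alpha>1 Q = qexp \<alpha>1 Q'" for Q Q'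
    using that by (simp add: qexp_def)
  obtain A B where "imag_unit A"
    "(sigma1 ^^ (2 * l)) (qexp \<alpha>1 (P1 \<phi>), qexp \<alpha>2 qi) = (qexp \<alpha>1 A, qexp \<alpha>2 B)"
    using sigma1_even_orbit by blast
  hence A: "imag_unit A" "Y1 l \<alpha>1 \<alpha>2 \<phi> = qexp \<alpha>1 A"
    by (simp_all add: Y1_def)
  show ?thesis
  proof (rule ex1I)
    show "imag_unit A \<and> Y1 l \<alpha>1 \<alpha>2 \<phi> = qexp \<alpha>1 A" using A by blast
    show "Q = A" if "imag_unit Q \<and> Y1 l \<alpha>1 \<alpha>2 \<phi> = qexp \<alpha>1 Q" for Q
      using that A(2) by (simp add: uniq)
  qed
qed

end

theory Submission
  imports Defs
begin

text \<open>
  The right-hand sides of the two equations are the same real number. Two steps of the braid action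
  conjugate both entries by their product \<open>C = X\<^sub>1 X\<^sub>2\<close>, and this product does not change; hence
  \<open>Q\<^sub>1 = C\<^sup>l P\<^sub>1 C\<^sup>-\<^sup>l\<close> (\<open>Q1_eq_conj\<close>). The real part of \<open>C\<close> is
  \<open>x = cos \<alpha>\<^sub>1 cos \<alpha>\<^sub>2 - cos \<phi> sin \<alpha>\<^sub>1 sin \<alpha>\<^sub>2\<close> and its imaginary part is the vector
  \<open>n\<close>, given by \<open>nvec\<close> (\<open>qexp_P1_mult_qexp_qi\<close>). So, with \<open>\<omega> = arccos x\<close> and
  \<open>N = n / |n|\<close>, the product is \<open>e\<^sup>\<omega>\<^sup>N\<close>, and conjugation by \<open>C\<^sup>l\<close> is the rotation about
  \<open>n\<close> through the angle \<open>2l\<omega>\<close> (\<open>qVec_qexp_conj\<close>, Rodrigues' formula).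

  Since \<open>d = n \<bullet> P\<^sub>1\<close>, the vector \<open>|n|\<^sup>2 P\<^sub>1 - d n\<close> is \<open>|n|\<^sup>2\<close> times the part of \<open>P\<^sub>1\<close>
  orthogonal to the axis. Its inner product with the rotated vector \<open>Q\<^sub>1\<close> is therefore
  \<open>cos (2l\<omega>)\<close> times its inner product with \<open>P\<^sub>1\<close>, namely \<open>cos (2l\<omega>) (|n|\<^sup>2 - d\<^sup>2)\<close>. As
  \<open>|n|\<^sup>2 - d\<^sup>2 = sin\<^sup>2 \<alpha>\<^sub>2 sin\<^sup>2 \<phi>\<close>, the quotient is \<open>cos (2l\<omega>) = T\<^sub>2\<^sub>l(x)\<close>.
\<close>

text \<open>
  \<open>\<sigma>\<^sub>1\<^sup>2\<close> sends \<open>(A, B)\<close> to its conjugate by \<open>A B\<close>. After \<open>l\<close> rounds the pair is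
  \<open>(X\<^sub>1, X\<^sub>2)\<close> conjugated by a power of \<open>X\<^sub>1 X\<^sub>2\<close>, which commutes with that product.
\<close>
lemma sigma1_even_power:
  assumes "X1 \<noteq> 0" "X2 \<noteq> 0"
  shows "(sigma1 ^^ (2 * l)) (X1, X2) =
    ((X1 * X2) ^ l * X1 * inverse ((X1 * X2) ^ l), (X1 * X2) ^ l * X2 * inverse ((X1 * X2) ^ l))"
proof (induction l)
  case 0
  show ?case by simp
next
  case (Suc l)
  define G where "G = (X1 * X2) ^ l"
  have G: "G \<noteq> 0" using assms by (simp add: G_def)
  have cancel: "inverse G * (G * z) = z" "inverse X1 * (X1 * z) = z"
    "X2 * (inverse X2 * z) = z" "inverse X2 * (X2 * z) = z" for z
    using assms G by (simp_all flip: mult.assoc)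
  have "(sigma1 ^^ (2 * Suc l)) (X1, X2) = sigma1 (sigma1 (G * X1 * inverse G, G * X2 * inverse G))"
    using Suc by (simp add: G_def)
  also have "\<dots> = ((G * (X1 * X2)) * X1 * inverse (G * (X1 * X2)),
      (G * (X1 * X2)) * X2 * inverse (G * (X1 * X2)))"
    using assms G by (simp add: sigma1_def nonzero_inverse_mult_distrib mult.assoc cancel)
  also have "G * (X1 * X2) = (X1 * X2) ^ Suc l"
    by (simp only: G_def power_Suc2)
  finally show ?case .
qed

lemma qexp_add:
  assumes "imag_unit Q"
  shows "qexp (a + b) Q = qexp a Q * qexp b Q"
proof -
  have "Q * Q = -1" using assms by (simp add: imag_unit_iff)
  thus ?thesis
    by (simp add: qexp_def of_real_def cos_add sin_add distrib_left distrib_right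
        scaleR_add_left scaleR_diff_left scaleR_add_right scaleR_diff_right mult.commute)
qed

lemma qexp_power:
  assumes "imag_unit Q"
  shows "qexp a Q ^ l = qexp (real l * a) Q"
proof (induction l)
  case 0
  show ?case by (simp add: qexp_def)
next
  case (Suc l)
  have "real (Suc l) * a = a + real l * a" by (simp add: algebra_simps)
  thus ?case by (simp add: Suc qexp_add[OF assms])
qed

lemma inverse_qexp:
  assumes "imag_unit Q"
  shows "inverse (qexp a Q) = qexp (- a) Q"
proof (rule inverse_unique)
  show "qexp a Q * qexp (- a) Q = 1"
    by (simp flip: qexp_add[OF assms]) (simp add: qexp_def)
qed

text \<open>
  Rodrigues' rotation formula: on imaginary quaternions, \<open>N P N = |N|\<^sup>2 P - 2 (N \<bullet> P) N\<close> and
  \<open>N P - P N = 2 N \<times> P\<close>; the double angle comes from collecting the coefficients.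
\<close>
lemma qVec_qexp_conj:
  assumes "imag_unit N" "qRe P = 0"
  shows "qVec (qexp b N * P * inverse (qexp b N)) =
    cos (2 * b) *\<^sub>R qVec P + sin (2 * b) *\<^sub>R cross3 (qVec N) (qVec P)
    + ((1 - cos (2 * b)) * (qVec N \<bullet> qVec P)) *\<^sub>R qVec N"
proof -
  define n where "n = qVec N"
  define p where "p = qVec P"
  have NP: "N = qImag n" "P = qImag p"
    using assms by (simp_all add: quat_eq_iff imag_unit_def n_def p_def)
  have nn: "n \<bullet> n = 1"
    using assms by (simp add: imag_unit_def n_def norm_eq_sqrt_inner)
  have "qVec (qexp b N * P * qexp (- b) N) =
      ((cos b)\<^sup>2 - (sin b)\<^sup>2 * (n \<bullet> n)) *\<^sub>R p + (2 * sin b * cos b) *\<^sub>R cross3 n p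
      + (2 * (sin b)\<^sup>2 * (n \<bullet> p)) *\<^sub>R n"
    by (simp add: NP qexp_def of_real_def quat_defs vec_eq_iff forall_3 cross3_def
        inner_vec_def sum_3 algebra_simps power2_eq_square)
  moreover have "1 - cos (2 * b) = 2 * (sin b)\<^sup>2"
    by (simp add: cos_double_sin)
  ultimately show ?thesis
    by (simp add: inverse_qexp[OF assms(1)] nn cos_double sin_double flip: n_def p_def)
qed

text \<open>
  The part of \<open>P\<close> orthogonal to the axis \<open>N\<close> is also orthogonal to \<open>N \<times> P\<close>, so of the three terms
  of Rodrigues' formula only \<open>cos (2b) P\<close> contributes.
\<close>
lemma inner_orthogonal_part_qexp_conj:
  assumes "imag_unit N" "qRe P = 0"
  shows "(qVec P - (qVec N \<bullet> qVec P) *\<^sub>R qVec N) \<bullet> qVec (qexp b N * P * inverse (qexp b N)) =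
    cos (2 * b) * (qVec P \<bullet> qVec P - (qVec N \<bullet> qVec P)\<^sup>2)"
proof -
  have "qVec N \<bullet> qVec N = 1"
    using assms by (simp add: imag_unit_def norm_eq_sqrt_inner)
  thus ?thesis
    unfolding qVec_qexp_conj[OF assms]
    by (simp add: inner_diff_left inner_add_right dot_cross_self
        inner_commute[of "qVec P" "qVec N"] algebra_simps power2_eq_square)
qed

lemma qexp_P1_mult_qexp_qi:
  "qexp \<alpha>1 (P1 \<phi>) * qexp \<alpha>2 qi =
    Quat (cos \<alpha>1 * cos \<alpha>2 - cos \<phi> * sin \<alpha>1 * sin \<alpha>2) (nvec \<alpha>1 \<alpha>2 \<phi>)"
  by (simp add: P1_eq qexp_def of_real_def qi_def qj_def quat_defs quat_eq_iff nvec_def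
      vec_eq_iff forall_3 cross3_def inner_vec_def sum_3 vector_3 algebra_simps)

lemma qVec_P1: "qVec (P1 \<phi>) = vector [cos \<phi>, sin \<phi>, 0]"
  by (simp add: P1_eq qi_def qj_def quat_defs vec_eq_iff forall_3 vector_3)

lemma nvec_inner_P1: "nvec \<alpha>1 \<alpha>2 \<phi> \<bullet> qVec (P1 \<phi>) = dfun \<alpha>1 \<alpha>2 \<phi>"
proof -
  have "nvec \<alpha>1 \<alpha>2 \<phi> \<bullet> qVec (P1 \<phi>) =
      (sin \<alpha>1 * cos \<alpha>2 * cos \<phi> + cos \<alpha>1 * sin \<alpha>2) * cos \<phi> + sin \<alpha>1 * cos \<alpha>2 * sin \<phi> * sin \<phi>"
    by (simp add: qVec_P1 nvec_def inner_vec_def sum_3 vector_3)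
  thus ?thesis
    unfolding dfun_def using sin_cos_squared_add[of \<phi>] by algebra
qed

text \<open>The product \<open>X\<^sub>1 X\<^sub>2\<close>, with imaginary part \<open>n\<close>, is a unit quaternion.\<close>
lemma norm_nvec_squared:
  "(norm (nvec \<alpha>1 \<alpha>2 \<phi>))\<^sup>2 = 1 - (cos \<alpha>1 * cos \<alpha>2 - cos \<phi> * sin \<alpha>1 * sin \<alpha>2)\<^sup>2"
proof -
  have "(norm (nvec \<alpha>1 \<alpha>2 \<phi>))\<^sup>2 =
      (sin \<alpha>1 * cos \<alpha>2 * cos \<phi> + cos \<alpha>1 * sin \<alpha>2)\<^sup>2 + (sin \<alpha>1 * cos \<alpha>2 * sin \<phi>)\<^sup>2
      + (sin \<alpha>1 * sin \<alpha>2 * sin \<phi>)\<^sup>2"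
    by (simp add: power2_norm_eq_inner nvec_def inner_vec_def sum_3 vector_3)
       (simp add: power2_eq_square)
  thus ?thesis
    using sin_cos_squared_add[of \<alpha>1] sin_cos_squared_add[of \<alpha>2] sin_cos_squared_add[of \<phi>]
    by algebra
qed

lemma norm_nvec_squared_minus_dfun_squared:
  "(norm (nvec \<alpha>1 \<alpha>2 \<phi>))\<^sup>2 - (dfun \<alpha>1 \<alpha>2 \<phi>)\<^sup>2 = (sin \<alpha>2)\<^sup>2 * (sin \<phi>)\<^sup>2"
  unfolding norm_nvec_squared dfun_def
  using sin_cos_squared_add[of \<alpha>1] sin_cos_squared_add[of \<alpha>2] sin_cos_squared_add[of \<phi>]
  by algebra

lemma Q1_eq_conj:
  fixes \<alpha>1 \<alpha>2 \<phi> :: real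
  assumes "0 < \<alpha>1" "\<alpha>1 < pi"
  defines "C \<equiv> qexp \<alpha>1 (P1 \<phi>) * qexp \<alpha>2 qi"
  shows "Q1 l \<alpha>1 \<alpha>2 \<phi> = C ^ l * P1 \<phi> * inverse (C ^ l)"
proof -
  have nz: "qexp \<alpha>1 (P1 \<phi>) \<noteq> 0" "qexp \<alpha>2 qi \<noteq> 0"
    by (simp_all add: qexp_nonzero imag_unit_P1 imag_unit_qi)
  hence C: "C ^ l \<noteq> 0" by (simp add: C_def)
  have "Y1 l \<alpha>1 \<alpha>2 \<phi> = qexp \<alpha>1 (C ^ l * P1 \<phi> * inverse (C ^ l))"
    unfolding Y1_def sigma1_even_power[OF nz] fst_conv C_def[symmetric] using C by (rule qexp_conj)
  moreover have "imag_unit (C ^ l * P1 \<phi> * inverse (C ^ l))"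
    using C imag_unit_P1 by (rule imag_unit_conj)
  ultimately show ?thesis
    unfolding Q1_def by (intro the1_equality Q1_ex1 assms conjI)
qed

theorem theorem5p4:
  fixes l :: nat and \<alpha>1 \<alpha>2 :: real
  assumes "l > 0"
    and "\<alpha>1 \<in> {0<..<pi}" and "\<alpha>2 \<in> {0<..<pi}"
    and "\<And>m :: int. (0 < m \<and> m < int l) \<or> (int l < m \<and> m < 2 * int l) \<Longrightarrow>
           \<alpha>1 + \<alpha>2 \<noteq> pi * of_int m / real l \<and> \<alpha>1 - \<alpha>2 + pi \<noteq> pi * of_int m / real l"
  shows "\<forall>\<phi> \<in> {0<..<pi}. \<forall>\<theta> \<in> {0..2 * pi}.
    cos \<theta> = (((norm (nvec \<alpha>1 \<alpha>2 \<phi>))\<^sup>2 *\<^sub>R qVec (P1 \<phi>) - dfun \<alpha>1 \<alpha>2 \<phi> *\<^sub>R nvec \<alpha>1 \<alpha>2 \<phi>)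
               \<bullet> qVec (Q1 l \<alpha>1 \<alpha>2 \<phi>)) / ((sin \<alpha>2)\<^sup>2 * (sin \<phi>)\<^sup>2)
    \<longleftrightarrow>
    cos \<theta> = poly (chebyshev_T (2 * l)) (cos \<alpha>1 * cos \<alpha>2 - cos \<phi> * sin \<alpha>1 * sin \<alpha>2)"
proof -
  have "((norm (nvec \<alpha>1 \<alpha>2 \<phi>))\<^sup>2 *\<^sub>R qVec (P1 \<phi>) - dfun \<alpha>1 \<alpha>2 \<phi> *\<^sub>R nvec \<alpha>1 \<alpha>2 \<phi>)
        \<bullet> qVec (Q1 l \<alpha>1 \<alpha>2 \<phi>) / ((sin \<alpha>2)\<^sup>2 * (sin \<phi>)\<^sup>2) =
      poly (chebyshev_T (2 * l)) (cos \<alpha>1 * cos \<alpha>2 - cos \<phi> * sin \<alpha>1 * sin \<alpha>2)"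
    if \<phi>: "\<phi> \<in> {0<..<pi}" for \<phi>
  proof -
    define x where "x = cos \<alpha>1 * cos \<alpha>2 - cos \<phi> * sin \<alpha>1 * sin \<alpha>2"
    define n where "n = nvec \<alpha>1 \<alpha>2 \<phi>"
    define p where "p = qVec (P1 \<phi>)"
    define d where "d = dfun \<alpha>1 \<alpha>2 \<phi>"
    define \<omega> where "\<omega> = arccos x"
    define N where "N = qImag (n /\<^sub>R norm n)"
    have S: "(sin \<alpha>2)\<^sup>2 * (sin \<phi>)\<^sup>2 > 0"
      using \<phi> assms(3) sin_gt_zero[of \<alpha>2] sin_gt_zero[of \<phi>] by simp
    have diff: "(norm n)\<^sup>2 - d\<^sup>2 = (sin \<alpha>2)\<^sup>2 * (sin \<phi>)\<^sup>2"
      unfolding n_def d_def by (rule norm_nvec_squared_minus_dfun_squared)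
    \<comment> \<open>The axis is well defined: \<open>|n|\<^sup>2\<close> is at least \<open>sin\<^sup>2 \<alpha>\<^sub>2 sin\<^sup>2 \<phi> > 0\<close>.\<close>
    have "(norm n)\<^sup>2 > 0"
      using diff S zero_le_power2[of d] by linarith
    hence n0: "norm n > 0" by simp
    have nx: "(norm n)\<^sup>2 = 1 - x\<^sup>2"
      unfolding n_def x_def by (rule norm_nvec_squared)
    have "x\<^sup>2 \<le> 1" using nx zero_le_power2[of "norm n"] by linarith
    hence "\<bar>x\<bar> \<le> 1" by (simp add: abs_square_le_1)
    hence x: "- 1 \<le> x" "x \<le> 1" by auto
    have cos: "cos \<omega> = x" using x by (simp add: \<omega>_def)
    have "sin \<omega> = sqrt (1 - x\<^sup>2)" using x by (simp add: \<omega>_def sin_arccos)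
    hence sin: "sin \<omega> = norm n" by (simp flip: nx)
    have N: "imag_unit N"
      using n0 by (simp add: imag_unit_def N_def)
    have "qexp \<alpha>1 (P1 \<phi>) * qexp \<alpha>2 qi = qexp \<omega> N"
      using n0 unfolding qexp_P1_mult_qexp_qi
      by (simp add: qexp_def of_real_def quat_defs N_def cos sin flip: x_def n_def)
    hence Q1: "Q1 l \<alpha>1 \<alpha>2 \<phi> = qexp (real l * \<omega>) N * P1 \<phi> * inverse (qexp (real l * \<omega>) N)"
      using Q1_eq_conj[of \<alpha>1 l \<alpha>2 \<phi>] assms(2) by (simp add: qexp_power[OF N])
    have P: "qRe (P1 \<phi>) = 0" "p \<bullet> p = 1"
      using imag_unit_P1[of \<phi>] by (simp_all add: imag_unit_def p_def norm_eq_sqrt_inner)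
    have NP: "qVec N \<bullet> p = d / norm n"
      using nvec_inner_P1[of \<alpha>1 \<alpha>2 \<phi>]
      by (simp add: N_def divide_inverse mult.commute flip: n_def p_def d_def)
    have "(norm n)\<^sup>2 *\<^sub>R p - d *\<^sub>R n = (norm n)\<^sup>2 *\<^sub>R (p - (qVec N \<bullet> p) *\<^sub>R qVec N)"
      using n0 unfolding NP
      by (simp add: N_def scaleR_diff_right power2_eq_square divide_simps)
    hence "((norm n)\<^sup>2 *\<^sub>R p - d *\<^sub>R n) \<bullet> qVec (Q1 l \<alpha>1 \<alpha>2 \<phi>) =
        (norm n)\<^sup>2 * (cos (2 * (real l * \<omega>)) * (p \<bullet> p - (qVec N \<bullet> p)\<^sup>2))"
      using inner_orthogonal_part_qexp_conj[OF N P(1), of "real l * \<omega>"]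
      by (simp add: Q1 flip: p_def)
    also have "\<dots> = cos (2 * (real l * \<omega>)) * ((norm n)\<^sup>2 - d\<^sup>2)"
      using n0 unfolding NP P(2) by (simp add: field_simps power_divide)
    finally have "((norm n)\<^sup>2 *\<^sub>R p - d *\<^sub>R n) \<bullet> qVec (Q1 l \<alpha>1 \<alpha>2 \<phi>) =
        cos (2 * (real l * \<omega>)) * ((sin \<alpha>2)\<^sup>2 * (sin \<phi>)\<^sup>2)"
      unfolding diff .
    moreover have "poly (chebyshev_T (2 * l)) x = cos (2 * (real l * \<omega>))"
      using is_chebyshev_T_chebyshev_T[of "2 * l"] cos
      by (auto simp: is_chebyshev_T_def mult.assoc)
    moreover have "sin \<alpha>2 \<noteq> 0" "sin \<phi> \<noteq> 0"
      using S by auto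
    ultimately show ?thesis
      by (simp flip: x_def n_def p_def d_def)
  qed
  thus ?thesis by metis
qed

end
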